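(* Let $m,n$ be integers with $2\le m<n$. Then: (1) $D_{\max}(K_{m,n})=\chi'_{D,\max}(K_{m,n})=n$, $D'_{\max}(K_{m,n})=D'(K_{m,n})$, and $\chi_{D,\max}(K_{m,n})=m+n$. (2) If $K_{m,n}$ admits a rigid orientation, then $D_{\min}(K_{m,n})=D'_{\min}(K_{m,n})=1$, $\chi_{D,\min}(K_{m,n})=2$ and $\chi'_{D,\min}(K_{m,n})=n$. (3) If $K_{m,n}$ does not admit any rigid orientation, then $D_{\min}(K_{m,n})\le \lceil n/(m-1)\rceil$, $\chi_{D,\min}(K_{m,n})\le 1+\lceil n/(m-1)\rceil$, $D'_{\min}(K_{m,n})\le D'(K_{m,\lceil n/(m-1)\rceil})$, and $\chi'_{D,\min}(K_{m,n})=n$.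
   Context: $K_{m,n}$ is the complete bipartite graph with parts of sizes $m$ and $n$. An orientation of a simple graph assigns one direction to each edge. An automorphism of an undirected graph is a vertex permutation preserving edges; an automorphism of an oriented graph is a permutation $\phi$ of its vertices such that $\phi(u)\phi(v)$ is an arc whenever $uv$ is an arc. A graph or oriented graph is rigid if its only automorphism is the identity. An $r$-vertex-labelling maps vertices to $\{1,\dots,r\}$, an $r$-edge-labelling ($r$-arc-labelling) maps edges (arcs) to $\{1,\dots,r\}$; colourings are proper labellings (adjacent vertices, resp. edges/arcs sharing an end-vertex, get distinct labels). A labelling $\lambda$ is distinguishing if the only automorphism $\phi$ with $\lambda(\phi(u))=\lambda(u)$ for all vertices (resp. $\lambda(\phi(u)\phi(v))=\lambda(uv)$ for all edges/arcs) is the identity. For an undirected graph $G$, $D'(G)$ is the least $r$ such that $G$ admits a distinguishing $r$-edge-labelling. For an oriented graph $\vec G$, $D(\vec G)$, $\chi_D(\vec G)$, $D'(\vec G)$, $\chi'_D(\vec G)$ are the least $r$ for which $\vec G$ admits a distinguishing $r$-vertex-labelling, $r$-vertex-colouring, $r$-arc-labelling, $r$-arc-colouring. For an undirected graph $G$, $D_{\min}(G)$ and $D_{\max}(G)$ are the minimum and maximum of $D(\vec G)$ over all orientations $\vec G$ of $G$; analogously $\chi_{D,\min},\chi_{D,\max}$ for $\chi_D$, $D'_{\min},D'_{\max}$ for $D'$, and $\chi'_{D,\min},\chi'_{D,\max}$ for $\chi'_D$. *)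

theory Defs
  imports Complex_Main "HOL-Library.FuncSet" "HOL-Combinatorics.Permutations"
begin

section \<open>Graphs and orientations\<close>

text \<open>A finite simple graph is a pair of a vertex set and a set of two-element vertex sets;
  an oriented graph is a pair of a vertex set and a set of ordered pairs (tail, head).\<close>

type_synonym 'a graph = "'a set \<times> 'a set set"
type_synonym 'a ograph = "'a set \<times> ('a \<times> 'a) set"

abbreviation verts :: "'a set \<times> 'b \<Rightarrow> 'a set" where "verts \<equiv> fst"
abbreviation edges :: "'a graph \<Rightarrow> 'a set set" where "edges \<equiv> snd"
abbreviation arcs :: "'a ograph \<Rightarrow> ('a \<times> 'a) set" where "arcs \<equiv> snd"

definition complete_bipartite :: "nat \<Rightarrow> nat \<Rightarrow> (nat + nat) graph" where
  "complete_bipartite m n =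
     (Inl ` {..<m} \<union> Inr ` {..<n}, {{Inl i, Inr j} | i j. i < m \<and> j < n})"

text \<open>Bijectivity says that every edge receives exactly one of its two directions, and that
  there are no other arcs.\<close>

definition orientation :: "'a graph \<Rightarrow> 'a ograph \<Rightarrow> bool" where
  "orientation G H \<longleftrightarrow>
     verts H = verts G \<and> bij_betw (\<lambda>(u, v). {u, v}) (arcs H) (edges G)"

section \<open>Automorphisms\<close>

text \<open>Here \<open>\<phi> permutes V\<close> includes that \<open>\<phi>\<close> fixes everything outside \<open>V\<close>, so that the
  identity automorphism is exactly \<open>id\<close>.\<close>

definition graph_aut :: "'a graph \<Rightarrow> ('a \<Rightarrow> 'a) \<Rightarrow> bool" where
  "graph_aut G \<phi> \<longleftrightarrow> \<phi> permutes verts G \<and> (\<forall>e\<in>edges G. \<phi> ` e \<in> edges G)"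

definition ograph_aut :: "'a ograph \<Rightarrow> ('a \<Rightarrow> 'a) \<Rightarrow> bool" where
  "ograph_aut H \<phi> \<longleftrightarrow> \<phi> permutes verts H \<and> (\<forall>(u, v)\<in>arcs H. (\<phi> u, \<phi> v) \<in> arcs H)"

definition rigid :: "'a ograph \<Rightarrow> bool" where
  "rigid H \<longleftrightarrow> (\<forall>\<phi>. ograph_aut H \<phi> \<longrightarrow> \<phi> = id)"

section \<open>Distinguishing labellings and colourings\<close>

definition distinguishing_edges :: "'a graph \<Rightarrow> ('a set \<Rightarrow> nat) \<Rightarrow> bool" where
  "distinguishing_edges G l \<longleftrightarrow>
     (\<forall>\<phi>. graph_aut G \<phi> \<and> (\<forall>e\<in>edges G. l (\<phi> ` e) = l e) \<longrightarrow> \<phi> = id)"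

definition distinguishing_verts :: "'a ograph \<Rightarrow> ('a \<Rightarrow> nat) \<Rightarrow> bool" where
  "distinguishing_verts H l \<longleftrightarrow>
     (\<forall>\<phi>. ograph_aut H \<phi> \<and> (\<forall>u\<in>verts H. l (\<phi> u) = l u) \<longrightarrow> \<phi> = id)"

definition distinguishing_arcs :: "'a ograph \<Rightarrow> ('a \<times> 'a \<Rightarrow> nat) \<Rightarrow> bool" where
  "distinguishing_arcs H l \<longleftrightarrow>
     (\<forall>\<phi>. ograph_aut H \<phi> \<and> (\<forall>(u, v)\<in>arcs H. l (\<phi> u, \<phi> v) = l (u, v)) \<longrightarrow> \<phi> = id)"

definition proper_verts :: "'a ograph \<Rightarrow> ('a \<Rightarrow> nat) \<Rightarrow> bool" where
  "proper_verts H l \<longleftrightarrow> (\<forall>(u, v)\<in>arcs H. l u \<noteq> l v)"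

text \<open>Two arcs conflict when they share an end-vertex, whatever their directions.\<close>

definition proper_arcs :: "'a ograph \<Rightarrow> ('a \<times> 'a \<Rightarrow> nat) \<Rightarrow> bool" where
  "proper_arcs H l \<longleftrightarrow>
     (\<forall>(u, v)\<in>arcs H. \<forall>(x, y)\<in>arcs H.
        (u, v) \<noteq> (x, y) \<and> {u, v} \<inter> {x, y} \<noteq> {} \<longrightarrow> l (u, v) \<noteq> l (x, y))"

section \<open>Distinguishing parameters\<close>

text \<open>An injective labelling of the vertices is always proper and distinguishing, and one of the
  edges or arcs is distinguishing except when the graph has a \<open>K\<^sub>2\<close> component (undirected
  case only) or at least two isolated vertices. So all the minima below are attained for the graphs \<open>K\<^bsub>m,n\<^esub>\<close> with \<open>m \<ge> 2\<close> and \<open>n \<ge> 1\<close>.\<close>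

definition D'_graph :: "'a graph \<Rightarrow> nat" where
  "D'_graph G = (LEAST r. \<exists>l \<in> edges G \<rightarrow> {1..r}. distinguishing_edges G l)"

definition D_ograph :: "'a ograph \<Rightarrow> nat" where
  "D_ograph H = (LEAST r. \<exists>l \<in> verts H \<rightarrow> {1..r}. distinguishing_verts H l)"

definition chiD_ograph :: "'a ograph \<Rightarrow> nat" where
  "chiD_ograph H =
     (LEAST r. \<exists>l \<in> verts H \<rightarrow> {1..r}. proper_verts H l \<and> distinguishing_verts H l)"

definition D'_ograph :: "'a ograph \<Rightarrow> nat" where
  "D'_ograph H = (LEAST r. \<exists>l \<in> arcs H \<rightarrow> {1..r}. distinguishing_arcs H l)"

definition chi'D_ograph :: "'a ograph \<Rightarrow> nat" where
  "chi'D_ograph H =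
     (LEAST r. \<exists>l \<in> arcs H \<rightarrow> {1..r}. proper_arcs H l \<and> distinguishing_arcs H l)"

text \<open>A finite graph has only finitely many orientations, so \<open>Min\<close> and \<open>Max\<close> are meaningful.\<close>

definition min_orient :: "('a ograph \<Rightarrow> nat) \<Rightarrow> 'a graph \<Rightarrow> nat" where
  "min_orient f G = Min {f H | H. orientation G H}"

definition max_orient :: "('a ograph \<Rightarrow> nat) \<Rightarrow> 'a graph \<Rightarrow> nat" where
  "max_orient f G = Max {f H | H. orientation G H}"

abbreviation "D_min \<equiv> min_orient D_ograph"
abbreviation "D_max \<equiv> max_orient D_ograph"
abbreviation "chiD_min \<equiv> min_orient chiD_ograph"
abbreviation "chiD_max \<equiv> max_orient chiD_ograph"
abbreviation "D'_min \<equiv> min_orient D'_ograph"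
abbreviation "D'_max \<equiv> max_orient D'_ograph"
abbreviation "chi'D_min \<equiv> min_orient chi'D_ograph"
abbreviation "chi'D_max \<equiv> max_orient chi'D_ograph"

end

theory Submission
  imports Defs
begin

text \<open>Since \<open>m \<noteq> n\<close>, the automorphisms of \<open>K\<^bsub>m,n\<^esub>\<close> are the maps that permute the two parts
  separately. For the maxima, orient all edges from the small part to the large one: this
  orientation keeps all automorphisms of \<open>K\<^bsub>m,n\<^esub>\<close>. The cyclic proper arc-colouring by \<open>i + j\<close>
  modulo \<open>n\<close> is preserved only by rotations, and no nontrivial rotation of \<open>\<int>/n\<close> maps
  \<open>{0..<m}\<close> to itself, so \<open>n\<close> colours always suffice. For the minima without a rigid
  orientation, give the vertices \<open>j\<close> of the large part the in-neighbourhoods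
  \<open>{0..j mod (m - 1)}\<close>: the nonempty proper initial segments of the small part. The degrees
  then fix the small part pointwise, and each class of \<open>j\<close>'s with equal in-neighbourhood has at
  most \<open>\<lceil>n / (m - 1)\<rceil>\<close> elements, which labels can tell apart.\<close>

section \<open>Orientations\<close>

text \<open>\<open>LEAST\<close> says nothing about a predicate that never holds. The witness
  \<open>k\<close> makes the least value itself satisfy \<open>P\<close>, so bounds on all solutions
  pass to it.\<close>

lemma ge_Least:
  fixes P :: "nat \<Rightarrow> bool"
  assumes "P k" and "\<And>r. P r \<Longrightarrow> a \<le> r"
  shows "a \<le> (LEAST r. P r)"
  using assms by (meson LeastI)

lemma orientation_arc_edge: "orientation G H \<Longrightarrow> (u, v) \<in> arcs H \<Longrightarrow> {u, v} \<in> edges G"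
  unfolding orientation_def using bij_betw_apply by fastforce

lemma orientation_edge_arcE:
  assumes "orientation G H" and "e \<in> edges G"
  obtains u v where "(u, v) \<in> arcs H" and "e = {u, v}"
proof -
  have "e \<in> (\<lambda>(u, v). {u, v}) ` arcs H"
    using assms unfolding orientation_def bij_betw_def by simp
  then show thesis using that by (elim imageE) (auto split: prod.splits)
qed

lemma orientation_edge_arc:
  assumes "orientation G H" and "{u, v} \<in> edges G"
  shows "(u, v) \<in> arcs H \<or> (v, u) \<in> arcs H"
  using orientation_edge_arcE[OF assms] by (metis doubleton_eq_iff)

lemma orientation_arc_inj:
  assumes "orientation G H" and "(u, v) \<in> arcs H" and "(x, y) \<in> arcs H" and "{u, v} = {x, y}"
  shows "(u, v) = (x, y)"
  using inj_onD[of "\<lambda>(u, v). {u, v}" "arcs H" "(u, v)" "(x, y)"] assms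
  by (simp add: orientation_def bij_betw_def)

lemma orientation_verts: "orientation G H \<Longrightarrow> verts H = verts G"
  by (simp add: orientation_def)

lemma finite_orientations:
  assumes "finite (verts G)" and "\<And>e. e \<in> edges G \<Longrightarrow> e \<subseteq> verts G"
  shows "finite {H. orientation G H}"
proof (rule finite_subset)
  show "{H. orientation G H} \<subseteq> {verts G} \<times> Pow (verts G \<times> verts G)"
  proof
    fix H :: "'a ograph"
    assume "H \<in> {H. orientation G H}"
    then have H: "orientation G H" by simp
    have "arcs H \<subseteq> verts G \<times> verts G"
      using assms(2)[OF orientation_arc_edge[OF H]] by auto
    then show "H \<in> {verts G} \<times> Pow (verts G \<times> verts G)"
      using orientation_verts[OF H] by (simp add: mem_Times_iff)
  qed
qed (use assms(1) in simp)

lemma ograph_aut_imp_graph_aut: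
  assumes "orientation G H" and "ograph_aut H \<phi>"
  shows "graph_aut G \<phi>"
  unfolding graph_aut_def
proof
  show "\<phi> permutes verts G"
    using assms by (simp add: ograph_aut_def orientation_def)
  show "\<forall>e\<in>edges G. \<phi> ` e \<in> edges G"
  proof
    fix e assume "e \<in> edges G"
    then obtain u v where "(u, v) \<in> arcs H" "e = {u, v}"
      using orientation_edge_arcE[OF assms(1)] by blast
    moreover from this have "(\<phi> u, \<phi> v) \<in> arcs H"
      using assms(2) by (auto simp: ograph_aut_def)
    ultimately show "\<phi> ` e \<in> edges G"
      using orientation_arc_edge[OF assms(1), of "\<phi> u" "\<phi> v"] by simp
  qed
qed

text \<open>An orientation has no automorphisms beyond those of \<open>G\<close>, so labels copied
  from edges to arcs stay distinguishing. This carries upper bounds from \<open>G\<close> to all its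
  orientations at once.\<close>

lemma distinguishing_arcs_of_edges:
  assumes "orientation G H" and "distinguishing_edges G l"
  shows "distinguishing_arcs H (\<lambda>(u, v). l {u, v})"
  unfolding distinguishing_arcs_def
proof (intro allI impI)
  fix \<phi>
  assume \<phi>: "ograph_aut H \<phi> \<and>
    (\<forall>(u, v)\<in>arcs H. (\<lambda>(u, v). l {u, v}) (\<phi> u, \<phi> v) = (\<lambda>(u, v). l {u, v}) (u, v))"
  have "l (\<phi> ` e) = l e" if "e \<in> edges G" for e
  proof -
    from that obtain u v where "(u, v) \<in> arcs H" "e = {u, v}"
      using orientation_edge_arcE[OF assms(1)] by blast
    then show ?thesis using \<phi> by auto
  qed
  then show "\<phi> = id"
    using assms(2) \<phi> ograph_aut_imp_graph_aut[OF assms(1)] by (auto simp: distinguishing_edges_def)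
qed

lemma edge_labelling_on_arcs:
  assumes "orientation G H" and "l \<in> edges G \<rightarrow> X"
  shows "(\<lambda>(u, v). l {u, v}) \<in> arcs H \<rightarrow> X"
  using orientation_arc_edge[OF assms(1)] assms(2) by auto

section \<open>Complete bipartite graphs\<close>

lemma verts_complete_bipartite:
  "verts (complete_bipartite m n) = Inl ` {..<m} \<union> Inr ` {..<n}"
  by (simp add: complete_bipartite_def)

lemma edges_complete_bipartite:
  "edges (complete_bipartite m n) = {{Inl i, Inr j} | i j. i < m \<and> j < n}"
  by (simp add: complete_bipartite_def)

lemma edge_complete_bipartite_iff [simp]:
  "{Inl i, Inr j} \<in> edges (complete_bipartite m n) \<longleftrightarrow> i < m \<and> j < n"
  by (auto simp: edges_complete_bipartite doubleton_eq_iff)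

lemma edge_complete_bipartite_iff' [simp]:
  "{Inr j, Inl i} \<in> edges (complete_bipartite m n) \<longleftrightarrow> i < m \<and> j < n"
  using edge_complete_bipartite_iff by (simp add: insert_commute)

lemma not_edge_complete_bipartite [simp]:
  "{Inl i, Inl i'} \<notin> edges (complete_bipartite m n)"
  "{Inr j, Inr j'} \<notin> edges (complete_bipartite m n)"
  by (auto simp: edges_complete_bipartite doubleton_eq_iff)

section \<open>Extremal values over all orientations\<close>

lemma finite_orientations_complete_bipartite:
  "finite {f H | H. orientation (complete_bipartite m n) H}"
proof -
  have "finite {H. orientation (complete_bipartite m n) H}"
    by (rule finite_orientations)
      (auto simp: verts_complete_bipartite edges_complete_bipartite)
  then have "finite (f ` {H. orientation (complete_bipartite m n) H})" by (rule finite_imageI)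
  then show ?thesis by (simp only: setcompr_eq_image)
qed

lemma min_orient_le:
  "orientation (complete_bipartite m n) H \<Longrightarrow> min_orient f (complete_bipartite m n) \<le> f H"
  unfolding min_orient_def by (intro Min_le finite_orientations_complete_bipartite) blast

lemma min_orient_eq:
  assumes "orientation (complete_bipartite m n) H" and "f H \<le> k"
    and "\<And>H. orientation (complete_bipartite m n) H \<Longrightarrow> k \<le> f H"
  shows "min_orient f (complete_bipartite m n) = k"
  unfolding min_orient_def
proof (rule Min_eqI[OF finite_orientations_complete_bipartite])
  have "f H = k" using assms by (blast intro: antisym)
  then show "k \<in> {f H | H. orientation (complete_bipartite m n) H}" using assms(1) by blast
qed (use assms(3) in blast)

lemma max_orient_eq:
  assumes "orientation (complete_bipartite m n) H" and "k \<le> f H"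
    and "\<And>H. orientation (complete_bipartite m n) H \<Longrightarrow> f H \<le> k"
  shows "max_orient f (complete_bipartite m n) = k"
  unfolding max_orient_def
proof (rule Max_eqI[OF finite_orientations_complete_bipartite])
  have "f H = k" using assms by (blast intro: antisym)
  then show "k \<in> {f H | H. orientation (complete_bipartite m n) H}" using assms(1) by blast
qed (use assms(3) in blast)

section \<open>Automorphisms of complete bipartite graphs with parts of different sizes\<close>

lemma map_sum_permutes:
  assumes "\<alpha> permutes A" and "\<beta> permutes B"
  shows "map_sum \<alpha> \<beta> permutes (Inl ` A \<union> Inr ` B)"
proof -
  have "bij \<alpha>" "bij \<beta>" using assms by (auto simp: permutes_bij)
  have "inj (map_sum \<alpha> \<beta>)"
    using \<open>bij \<alpha>\<close> \<open>bij \<beta>\<close> by (simp add: bij_is_inj sum.inj_map)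
  moreover have "surj (map_sum \<alpha> \<beta>)"
    using \<open>bij \<alpha>\<close> \<open>bij \<beta>\<close> by (simp add: bij_is_surj sum.map_comp surj_def)
      (metis bij_pointE map_sum.simps sumE)
  ultimately have "bij (map_sum \<alpha> \<beta>)" by (simp add: bij_def)
  moreover have "map_sum \<alpha> \<beta> x = x" if "x \<notin> Inl ` A \<union> Inr ` B" for x
    using that assms by (cases x) (auto simp: permutes_def)
  ultimately show ?thesis by (simp add: permutes_def bij_iff)
qed

lemma map_sum_eq_id_iff: "map_sum \<alpha> \<beta> = id \<longleftrightarrow> \<alpha> = id \<and> \<beta> = id"
proof
  assume *: "map_sum \<alpha> \<beta> = id"
  have "\<alpha> i = i" for i using fun_cong[OF *, of "Inl i"] by simp
  moreover have "\<beta> j = j" for j using fun_cong[OF *, of "Inr j"] by simp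
  ultimately show "\<alpha> = id \<and> \<beta> = id" by auto
qed (simp add: sum.map_id0)

lemma graph_aut_map_sum:
  assumes "\<alpha> permutes {..<m}" and "\<beta> permutes {..<n}"
  shows "graph_aut (complete_bipartite m n) (map_sum \<alpha> \<beta>)"
  unfolding graph_aut_def
proof (intro conjI ballI)
  show "map_sum \<alpha> \<beta> permutes verts (complete_bipartite m n)"
    using map_sum_permutes[OF assms] by (simp add: verts_complete_bipartite)
  fix e assume "e \<in> edges (complete_bipartite m n)"
  then obtain i j where "e = {Inl i, Inr j}" "i < m" "j < n"
    by (auto simp: edges_complete_bipartite)
  then show "map_sum \<alpha> \<beta> ` e \<in> edges (complete_bipartite m n)"
    using permutes_in_image[OF assms(1), of i] permutes_in_image[OF assms(2), of j] by simp
qed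

text \<open>If \<open>Inl i\<close> went to the large part, adjacency would force its n neighbours,
  the whole large part, injectively into the small part, which has only m < n vertices.\<close>

lemma graph_aut_preserves_part:
  assumes "m < n" and aut: "graph_aut (complete_bipartite m n) \<phi>" and "i < m"
  obtains i' where "i' < m" and "\<phi> (Inl i) = Inl i'"
proof (cases "\<phi> (Inl i)")
  case (Inl i')
  have perm: "\<phi> permutes (Inl ` {..<m} \<union> Inr ` {..<n})"
    using aut by (simp add: graph_aut_def verts_complete_bipartite)
  then have "\<phi> (Inl i) \<in> Inl ` {..<m} \<union> Inr ` {..<n}"
    using \<open>i < m\<close> permutes_in_image[OF perm, of "Inl i"] by simp
  then show ?thesis using Inl that by auto
next
  case (Inr j')
  have perm: "\<phi> permutes (Inl ` {..<m} \<union> Inr ` {..<n})"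
    using aut by (simp add: graph_aut_def verts_complete_bipartite)
  have "\<phi> ` (Inr ` {..<n}) \<subseteq> Inl ` {..<m}"
  proof (rule image_subsetI)
    fix x assume "x \<in> (Inr ` {..<n} :: (nat + nat) set)"
    then obtain j where j: "x = Inr j" "j < n" by auto
    have "{Inl i, Inr j} \<in> edges (complete_bipartite m n)"
      using \<open>i < m\<close> j by simp
    then have "\<phi> ` {Inl i, Inr j} \<in> edges (complete_bipartite m n)"
      using aut unfolding graph_aut_def by blast
    then have "{Inr j', \<phi> x} \<in> edges (complete_bipartite m n)"
      using Inr j by simp
    then show "\<phi> x \<in> Inl ` {..<m}" by (cases "\<phi> x") auto
  qed
  moreover have "inj_on \<phi> (Inr ` {..<n})"
    using perm by (meson permutes_inj inj_on_subset subset_UNIV)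
  ultimately have "card (Inr ` {..<n} :: (nat + nat) set) \<le> card (Inl ` {..<m} :: (nat + nat) set)"
    by (intro card_inj_on_le) auto
  then show ?thesis using \<open>m < n\<close> by (simp add: card_image)
qed

text \<open>The small part is mapped into itself, hence onto itself by finiteness, and bijectivity
  then sends the complement to the complement.\<close>

lemma graph_aut_complete_bipartite:
  assumes "m < n" and aut: "graph_aut (complete_bipartite m n) \<phi>"
  obtains \<alpha> \<beta> where "\<alpha> permutes {..<m}" and "\<beta> permutes {..<n}" and "\<phi> = map_sum \<alpha> \<beta>"
proof -
  have perm: "\<phi> permutes (Inl ` {..<m} \<union> Inr ` {..<n})"
    using aut by (simp add: graph_aut_def verts_complete_bipartite)
  have inj: "inj \<phi>" using perm by (rule permutes_inj)
  have "\<phi> ` Inl ` {..<m} \<subseteq> Inl ` {..<m}"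
    unfolding image_image
  proof (rule image_subsetI)
    fix i :: nat assume "i \<in> {..<m}"
    then obtain i' where "i' < m" "\<phi> (Inl i) = Inl i'"
      using graph_aut_preserves_part[OF assms, of i] by auto
    then show "\<phi> (Inl i) \<in> Inl ` {..<m}" by simp
  qed
  then have imgl: "\<phi> ` Inl ` {..<m} = Inl ` {..<m}"
    by (rule endo_inj_surj[rotated]) (auto intro: inj_on_subset[OF inj])
  have imgr: "\<phi> ` Inr ` {..<n} = Inr ` {..<n}"
  proof -
    have eq: "(Inr ` {..<n} :: (nat + nat) set) = (Inl ` {..<m} \<union> Inr ` {..<n}) - Inl ` {..<m}"
      by auto
    have "\<phi> ` ((Inl ` {..<m} \<union> Inr ` {..<n}) - Inl ` {..<m}) =
        (Inl ` {..<m} \<union> Inr ` {..<n}) - Inl ` {..<m}"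
      by (simp only: image_set_diff[OF inj] permutes_image[OF perm] imgl)
    then show ?thesis by (simp only: eq[symmetric])
  qed
  \<comment> \<open>Indices outside the range are covered too, since \<open>\<phi>\<close> is the
    identity there. So \<open>\<alpha>\<close> and \<open>\<beta>\<close> come out as total
    functions that fix everything outside the parts, as \<open>permutes\<close> demands.\<close>
  have left: "\<exists>i'. \<phi> (Inl i) = Inl i' \<and> (i' < m \<longleftrightarrow> i < m)" for i
  proof (cases "i < m")
    case True
    then have "\<phi> (Inl i) \<in> Inl ` {..<m}" using imgl by blast
    then show ?thesis using True by auto
  next
    case False
    then have "\<phi> (Inl i) = Inl i" using permutes_not_in[OF perm, of "Inl i"] by auto
    then show ?thesis by simp
  qed
  have right: "\<exists>j'. \<phi> (Inr j) = Inr j' \<and> (j' < n \<longleftrightarrow> j < n)" for j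
  proof (cases "j < n")
    case True
    then have "\<phi> (Inr j) \<in> Inr ` {..<n}" using imgr by blast
    then show ?thesis using True by auto
  next
    case False
    then have "\<phi> (Inr j) = Inr j" using permutes_not_in[OF perm, of "Inr j"] by auto
    then show ?thesis by simp
  qed
  obtain \<alpha> where \<alpha>: "\<And>i. \<phi> (Inl i) = Inl (\<alpha> i)" "\<And>i. \<alpha> i < m \<longleftrightarrow> i < m"
    using left by metis
  obtain \<beta> where \<beta>: "\<And>j. \<phi> (Inr j) = Inr (\<beta> j)" "\<And>j. \<beta> j < n \<longleftrightarrow> j < n"
    using right by metis
  have "\<alpha> permutes {..<m}"
  proof (rule inj_imp_permutes)
    show "inj_on \<alpha> {..<m}"
    proof (rule inj_onI)
      fix x y assume "\<alpha> x = \<alpha> y"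
      then have "\<phi> (Inl x) = \<phi> (Inl y)" by (simp add: \<alpha>(1))
      then show "x = y" using injD[OF inj] by blast
    qed
    show "\<alpha> i = i" if "i \<notin> {..<m}" for i
      using that \<alpha>(1) permutes_not_in[OF perm, of "Inl i"] by auto
  qed (use \<alpha>(2) in auto)
  moreover have "\<beta> permutes {..<n}"
  proof (rule inj_imp_permutes)
    show "inj_on \<beta> {..<n}"
    proof (rule inj_onI)
      fix x y assume "\<beta> x = \<beta> y"
      then have "\<phi> (Inr x) = \<phi> (Inr y)" by (simp add: \<beta>(1))
      then show "x = y" using injD[OF inj] by blast
    qed
    show "\<beta> j = j" if "j \<notin> {..<n}" for j
      using that \<beta>(1) permutes_not_in[OF perm, of "Inr j"] by auto
  qed (use \<beta>(2) in auto)
  moreover have "\<phi> = map_sum \<alpha> \<beta>"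
  proof
    show "\<phi> x = map_sum \<alpha> \<beta> x" for x using \<alpha>(1) \<beta>(1) by (cases x) auto
  qed
  ultimately show thesis by (rule that)
qed

text \<open>A column is the family of labels at one vertex of the second part. If two columns
  agreed, transposing their vertices would be a nontrivial automorphism that preserves
  labels.\<close>

lemma distinguishing_edges_columns:
  assumes "distinguishing_edges (complete_bipartite m n) l" and "s < n" and "t < n"
    and "\<And>i. i < m \<Longrightarrow> l {Inl i, Inr s} = l {Inl i, Inr t}"
  shows "s = t"
proof -
  let ?\<phi> = "map_sum id (transpose s t) :: nat + nat \<Rightarrow> nat + nat"
  have "graph_aut (complete_bipartite m n) ?\<phi>"
    using assms(2,3) by (intro graph_aut_map_sum permutes_id permutes_swap_id) auto
  moreover have "l (?\<phi> ` e) = l e" if "e \<in> edges (complete_bipartite m n)" for e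
    using that assms(4) by (auto simp: edges_complete_bipartite transpose_def)
  ultimately have "?\<phi> = id"
    using assms(1) by (auto simp: distinguishing_edges_def)
  then have "transpose s t = id" by (simp add: map_sum_eq_id_iff)
  then show ?thesis by (metis id_apply transpose_apply_first)
qed

section \<open>Labellings of the edges\<close>

text \<open>An edge is an unordered set, but the tags tell its ends apart. So an edge labelling can
  be given as a matrix \<open>f\<close>, with rows for the first part and columns for the
  second.\<close>

definition bip_label :: "(nat \<Rightarrow> nat \<Rightarrow> nat) \<Rightarrow> (nat + nat) set \<Rightarrow> nat" where
  "bip_label f e = f (THE i. Inl i \<in> e) (THE j. Inr j \<in> e)"

lemma bip_label [simp]: "bip_label f {Inl i, Inr j} = f i j" "bip_label f {Inr j, Inl i} = f i j"
  by (simp_all add: bip_label_def)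

text \<open>Makes the \<open>LEAST\<close> in \<open>D'_graph\<close> attained. Injective labels fix
  every edge as a set; two edges at a vertex of the second part meet only in that vertex, which is
  where \<open>2 \<le> m\<close> enters, and an edge with one end fixed has the other fixed
  too.\<close>

lemma exists_distinguishing_edges:
  assumes "2 \<le> m" and "1 \<le> n"
  shows "\<exists>r. \<exists>l \<in> edges (complete_bipartite m n) \<rightarrow> {1..r}.
           distinguishing_edges (complete_bipartite m n) l"
proof -
  let ?K = "complete_bipartite m n"
  have "finite (edges ?K)"
    by (rule finite_subset[of _ "Pow (verts ?K)"])
      (auto simp: edges_complete_bipartite verts_complete_bipartite)
  then obtain l :: "(nat + nat) set \<Rightarrow> nat" where
    l: "bij_betw l (edges ?K) {0..<card (edges ?K)}"
    using ex_bij_betw_finite_nat by blast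
  have "distinguishing_edges ?K (Suc \<circ> l)"
    unfolding distinguishing_edges_def
  proof (intro allI impI)
    fix \<phi> assume \<phi>: "graph_aut ?K \<phi> \<and> (\<forall>e\<in>edges ?K. (Suc \<circ> l) (\<phi> ` e) = (Suc \<circ> l) e)"
    then have perm: "\<phi> permutes verts ?K" by (simp add: graph_aut_def)
    have fix_edge: "\<phi> ` e = e" if "e \<in> edges ?K" for e
      using \<phi> that bij_betw_imp_inj_on[OF l] by (auto simp: graph_aut_def inj_on_def)
    have fix_edge': "{\<phi> (Inl i), \<phi> (Inr j)} = {Inl i, Inr j}" if "i < m" "j < n" for i j
      using fix_edge[of "{Inl i, Inr j}"] that by simp
    have right: "\<phi> (Inr j) = Inr j" if "j < n" for j
      using fix_edge'[of 0 j] fix_edge'[of 1 j] that \<open>2 \<le> m\<close> by (auto simp: doubleton_eq_iff)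
    have left: "\<phi> (Inl i) = Inl i" if "i < m" for i
      using fix_edge'[of i 0] right[of 0] that \<open>1 \<le> n\<close> by (auto simp: doubleton_eq_iff)
    show "\<phi> = id"
    proof
      show "\<phi> x = id x" for x
        using left right permutes_not_in[OF perm, of x]
        by (cases "x \<in> verts ?K") (auto simp: verts_complete_bipartite)
    qed
  qed
  moreover have "Suc \<circ> l \<in> edges ?K \<rightarrow> {1..card (edges ?K)}"
    using bij_betwE[OF l] by (auto simp: Suc_le_eq)
  ultimately show ?thesis by blast
qed

lemma D'_graph_attained:
  assumes "2 \<le> m" and "1 \<le> n"
  obtains l where "l \<in> edges (complete_bipartite m n) \<rightarrow> {1..D'_graph (complete_bipartite m n)}"
    and "distinguishing_edges (complete_bipartite m n) l"
  using LeastI_ex[OF exists_distinguishing_edges[OF assms]] unfolding D'_graph_def by blast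

section \<open>The cyclic labelling\<close>

lemma eq_if_add_mod_eq:
  fixes a b c n :: nat
  assumes "(a + c) mod n = (b + c) mod n" and "a < n" and "b < n"
  shows "a = b"
proof -
  have "int n dvd (int a + int c) - (int b + int c)"
    using assms(1) by (metis mod_eq_dvd_iff of_nat_add of_nat_mod)
  then have "int n dvd int a - int b" by simp
  then have "int a mod int n = int b mod int n" by (simp add: mod_eq_dvd_iff)
  then show ?thesis using assms(2,3) by simp
qed

text \<open>The addition table of the integers modulo n, shifted by 1 into the range of labels; its
  first m rows form a Latin rectangle when m < n.\<close>

abbreviation cyclic_label :: "nat \<Rightarrow> (nat + nat) set \<Rightarrow> nat" where
  "cyclic_label n \<equiv> bip_label (\<lambda>i j. 1 + (i + j) mod n)"

text \<open>Preserved labels mean that \<open>\<alpha> i + \<beta> j\<close> and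
  \<open>i + j\<close> agree modulo n, so \<open>\<alpha>\<close> is a rotation by a constant. A
  nonzero rotation would move some row index out of the first m residues; once
  \<open>\<alpha>\<close> is trivial, the congruence makes \<open>\<beta>\<close> trivial.\<close>

lemma cyclic_label_distinguishing:
  assumes "0 < m" and "m < n"
  shows "distinguishing_edges (complete_bipartite m n) (cyclic_label n)"
  unfolding distinguishing_edges_def
proof (intro allI impI, elim conjE)
  fix \<phi>
  assume aut: "graph_aut (complete_bipartite m n) \<phi>"
    and lab: "\<forall>e\<in>edges (complete_bipartite m n). cyclic_label n (\<phi> ` e) = cyclic_label n e"
  obtain \<alpha> \<beta> where \<alpha>: "\<alpha> permutes {..<m}" and \<beta>: "\<beta> permutes {..<n}" and \<phi>: "\<phi> = map_sum \<alpha> \<beta>"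
    using graph_aut_complete_bipartite[OF assms(2) aut] .
  have \<alpha>_lt: "\<alpha> i < m" if "i < m" for i using permutes_in_image[OF \<alpha>, of i] that by simp
  have \<beta>_lt: "\<beta> j < n" if "j < n" for j using permutes_in_image[OF \<beta>, of j] that by simp
  have sum_mod: "(\<alpha> i + \<beta> j) mod n = (i + j) mod n" if "i < m" "j < n" for i j
    using lab[rule_format, of "{Inl i, Inr j}"] that by (simp add: \<phi>)
  have \<alpha>_id: "\<alpha> i = i" if "i < m" for i
  proof -
    define c where "c = \<alpha> 0"
    have "c < m" using \<alpha>_lt[OF \<open>0 < m\<close>] by (simp add: c_def)
    \<comment> \<open>The column \<open>j = 0\<close> in the rows \<open>k\<close> and
      \<open>0\<close> shows that \<open>c\<close> is the negative of \<open>\<beta> 0\<close>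
      modulo n; adding \<open>c\<close> to the congruence for \<open>k\<close> isolates
      \<open>\<alpha> k\<close>.\<close>
    have shift: "\<alpha> k = (k + c) mod n" if "k < m" for k
    proof -
      have "(\<alpha> k + \<beta> 0) mod n = k mod n" "(c + \<beta> 0) mod n = 0"
        using sum_mod[OF that, of 0] sum_mod[OF \<open>0 < m\<close>, of 0] assms by (simp_all add: c_def)
      then have "(\<alpha> k + \<beta> 0 + c) mod n = (k + c) mod n" "(\<alpha> k + (c + \<beta> 0)) mod n = \<alpha> k mod n"
        by (metis mod_add_left_eq, metis mod_add_right_eq add.right_neutral)
      then have "\<alpha> k mod n = (k + c) mod n" by (simp add: ac_simps)
      then show ?thesis using \<alpha>_lt[OF that] assms by simp
    qed
    have "c = 0"
    proof (rule ccontr)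
      assume "c \<noteq> 0"
      \<comment> \<open>\<open>m - c\<close> is a row since \<open>0 < c\<close>. Its rotated index
        is m, which reduction modulo n leaves alone because m < n; but m is not a row.\<close>
      then have "\<alpha> (m - c) = m" using shift[of "m - c"] \<open>c < m\<close> assms by simp
      then show False using \<alpha>_lt[of "m - c"] \<open>c \<noteq> 0\<close> \<open>c < m\<close> by simp
    qed
    then show ?thesis using shift[OF that] that assms by simp
  qed
  have \<beta>_id: "\<beta> j = j" if "j < n" for j
    using sum_mod[OF \<open>0 < m\<close> that] \<alpha>_id[OF \<open>0 < m\<close>] \<beta>_lt[OF that] that by simp
  have "\<alpha> = id" "\<beta> = id"
    using \<alpha>_id \<beta>_id permutes_not_in[OF \<alpha>] permutes_not_in[OF \<beta>]
    by (metis eq_id_iff lessThan_iff)+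
  then show "\<phi> = id" by (simp add: \<phi> map_sum_eq_id_iff)
qed

text \<open>Arcs that meet share a row or a column, where equal labels force equal edges by
  cancellation modulo n. Equal edges give equal arcs, since an orientation uses each edge
  once.\<close>

lemma cyclic_label_proper:
  assumes "m < n" and H: "orientation (complete_bipartite m n) H"
  shows "proper_arcs H (\<lambda>(u, v). cyclic_label n {u, v})"
proof -
  have "(u, v) = (x, y)"
    if uv: "(u, v) \<in> arcs H" and xy: "(x, y) \<in> arcs H"
      and meet: "{u, v} \<inter> {x, y} \<noteq> {}" and eq: "cyclic_label n {u, v} = cyclic_label n {x, y}"
    for u v x y
  proof -
    obtain i j where 1: "{u, v} = {Inl i, Inr j}" "i < m" "j < n"
      using orientation_arc_edge[OF H uv] by (auto simp: edges_complete_bipartite)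
    obtain i' j' where 2: "{x, y} = {Inl i', Inr j'}" "i' < m" "j' < n"
      using orientation_arc_edge[OF H xy] by (auto simp: edges_complete_bipartite)
    have "i = i' \<or> j = j'" using meet unfolding 1 2 by auto
    moreover have "(i + j) mod n = (i' + j') mod n" using eq unfolding 1 2 by simp
    ultimately have "i = i' \<and> j = j'"
    proof (elim disjE)
      assume "i = i'" "(i + j) mod n = (i' + j') mod n"
      then show ?thesis using eq_if_add_mod_eq[of j i n j'] 1(3) 2(3) by (simp add: add.commute)
    next
      assume "j = j'" "(i + j) mod n = (i' + j') mod n"
      then show ?thesis using eq_if_add_mod_eq[of i j n i'] 1(2) 2(2) assms(1) by simp
    qed
    then have "{u, v} = {x, y}" using 1 2 by simp
    then show ?thesis using orientation_arc_inj[OF H uv xy] by simp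
  qed
  then show ?thesis unfolding proper_arcs_def by fast
qed

text \<open>The vertex \<open>Inl 0\<close> has degree n and its arcs conflict pairwise, whatever
  their directions.\<close>

lemma proper_arcs_ge:
  assumes "0 < m" and H: "orientation (complete_bipartite m n) H"
    and l: "l \<in> arcs H \<rightarrow> {1..r}" and proper: "proper_arcs H l"
  shows "n \<le> r"
proof -
  define a :: "nat \<Rightarrow> (nat + nat) \<times> (nat + nat)" where
    "a j = (if (Inl 0, Inr j) \<in> arcs H then (Inl 0, Inr j) else (Inr j, Inl 0))" for j
  have a: "a j \<in> arcs H" if "j < n" for j
    using orientation_edge_arc[OF H, of "Inl 0" "Inr j"] that assms(1) by (auto simp: a_def)
  have "inj_on (l \<circ> a) {..<n}"
  proof (rule inj_onI, rule ccontr)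
    fix j k
    assume jk: "j \<in> {..<n}" "k \<in> {..<n}" "(l \<circ> a) j = (l \<circ> a) k" "j \<noteq> k"
    obtain u v x y where uv: "a j = (u, v)" and xy: "a k = (x, y)" by (metis surj_pair)
    have "(u, v) \<noteq> (x, y)" "{u, v} \<inter> {x, y} \<noteq> {}"
      using uv xy jk(4) by (auto simp: a_def split: if_splits)
    moreover have "(u, v) \<in> arcs H" "(x, y) \<in> arcs H"
      using a[of j] a[of k] jk uv xy by auto
    ultimately have "l (u, v) \<noteq> l (x, y)" using proper unfolding proper_arcs_def by fast
    then show False using jk(3) uv xy by simp
  qed
  moreover have "(l \<circ> a) ` {..<n} \<subseteq> {1..r}" using a l by auto
  ultimately have "card {..<n} \<le> card {1..r}" by (rule card_inj_on_le) simp
  then show ?thesis by simp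
qed

section \<open>Orientations given by a relation\<close>

text \<open>The relation is a 0/1 matrix recording the direction of each edge. In this form the
  automorphisms that respect the parts become pairs of a row and a column permutation preserving the
  matrix.\<close>

definition bip_orient :: "nat \<Rightarrow> nat \<Rightarrow> (nat \<Rightarrow> nat \<Rightarrow> bool) \<Rightarrow> (nat + nat) ograph" where
  "bip_orient m n R = (verts (complete_bipartite m n),
     {(Inl i, Inr j) | i j. i < m \<and> j < n \<and> R i j} \<union>
     {(Inr j, Inl i) | i j. i < m \<and> j < n \<and> \<not> R i j})"

lemma arcs_bip_orient [simp]:
  "(Inl i, Inr j) \<in> arcs (bip_orient m n R) \<longleftrightarrow> i < m \<and> j < n \<and> R i j"
  "(Inr j, Inl i) \<in> arcs (bip_orient m n R) \<longleftrightarrow> i < m \<and> j < n \<and> \<not> R i j"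
  by (auto simp: bip_orient_def)

lemma bip_orient_arcE:
  assumes "(u, v) \<in> arcs (bip_orient m n R)"
  obtains i j where "i < m" "j < n" "R i j" "u = Inl i" "v = Inr j"
    | i j where "i < m" "j < n" "\<not> R i j" "u = Inr j" "v = Inl i"
  using assms by (auto simp: bip_orient_def)

lemma verts_bip_orient: "verts (bip_orient m n R) = Inl ` {..<m} \<union> Inr ` {..<n}"
  by (simp add: bip_orient_def verts_complete_bipartite)

lemma orientation_bip_orient: "orientation (complete_bipartite m n) (bip_orient m n R)"
  unfolding orientation_def
proof
  show "bij_betw (\<lambda>(u, v). {u, v}) (arcs (bip_orient m n R)) (edges (complete_bipartite m n))"
  proof (rule bij_betw_imageI)
    show "inj_on (\<lambda>(u, v). {u, v}) (arcs (bip_orient m n R))"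
    proof (rule inj_onI, clarsimp)
      fix u v x y
      assume "(u, v) \<in> arcs (bip_orient m n R)" "(x, y) \<in> arcs (bip_orient m n R)" "{u, v} = {x, y}"
      then show "u = x \<and> v = y"
        by (elim bip_orient_arcE) (simp_all add: doubleton_eq_iff)
    qed
    show "(\<lambda>(u, v). {u, v}) ` arcs (bip_orient m n R) = edges (complete_bipartite m n)"
    proof
      show "(\<lambda>(u, v). {u, v}) ` arcs (bip_orient m n R) \<subseteq> edges (complete_bipartite m n)"
        by (auto elim!: bip_orient_arcE)
      show "edges (complete_bipartite m n) \<subseteq> (\<lambda>(u, v). {u, v}) ` arcs (bip_orient m n R)"
      proof
        fix e assume "e \<in> edges (complete_bipartite m n)"
        then obtain i j where e: "e = {Inl i, Inr j}" "i < m" "j < n"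
          by (auto simp: edges_complete_bipartite)
        show "e \<in> (\<lambda>(u, v). {u, v}) ` arcs (bip_orient m n R)"
        proof (cases "R i j")
          case True
          then show ?thesis using e by (intro image_eqI[of _ _ "(Inl i, Inr j)"]) auto
        next
          case False
          then show ?thesis using e by (intro image_eqI[of _ _ "(Inr j, Inl i)"]) auto
        qed
      qed
    qed
  qed
qed (simp add: bip_orient_def)

lemma ograph_aut_bip_orient:
  assumes "\<alpha> permutes {..<m}" and "\<beta> permutes {..<n}"
  shows "ograph_aut (bip_orient m n R) (map_sum \<alpha> \<beta>) \<longleftrightarrow>
           (\<forall>i<m. \<forall>j<n. R (\<alpha> i) (\<beta> j) \<longleftrightarrow> R i j)"
proof -
  have lt: "\<alpha> i < m \<longleftrightarrow> i < m" "\<beta> j < n \<longleftrightarrow> j < n" for i j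
    using permutes_in_image[OF assms(1), of i] permutes_in_image[OF assms(2), of j] by simp_all
  show ?thesis
  proof
    assume aut: "ograph_aut (bip_orient m n R) (map_sum \<alpha> \<beta>)"
    show "\<forall>i<m. \<forall>j<n. R (\<alpha> i) (\<beta> j) \<longleftrightarrow> R i j"
    proof (intro allI impI)
      fix i j assume ij: "i < m" "j < n"
      have step: "(map_sum \<alpha> \<beta> u, map_sum \<alpha> \<beta> v) \<in> arcs (bip_orient m n R)"
        if "(u, v) \<in> arcs (bip_orient m n R)" for u v
        using aut that by (auto simp: ograph_aut_def)
      \<comment> \<open>A forward arc on the edge gives one implication, a backward arc the
        other.\<close>
      show "R (\<alpha> i) (\<beta> j) \<longleftrightarrow> R i j"
        using step[of "Inl i" "Inr j"] step[of "Inr j" "Inl i"] ij by auto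
    qed
  next
    assume *: "\<forall>i<m. \<forall>j<n. R (\<alpha> i) (\<beta> j) \<longleftrightarrow> R i j"
    have "(map_sum \<alpha> \<beta> u, map_sum \<alpha> \<beta> v) \<in> arcs (bip_orient m n R)"
      if "(u, v) \<in> arcs (bip_orient m n R)" for u v
      using that by (rule bip_orient_arcE) (use * lt in simp_all)
    then show "ograph_aut (bip_orient m n R) (map_sum \<alpha> \<beta>)"
      using map_sum_permutes[OF assms] by (auto simp: ograph_aut_def verts_bip_orient)
  qed
qed

section \<open>The orientation of all edges from the first part to the second\<close>

abbreviation forward :: "nat \<Rightarrow> nat \<Rightarrow> (nat + nat) ograph" where
  "forward m n \<equiv> bip_orient m n (\<lambda>i j. True)"

text \<open>Every pair of permutations of the parts is an automorphism here, so two vertices of one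
  part with the same label could be swapped.\<close>

lemma forward_distinguishing_inj:
  assumes dist: "distinguishing_verts (forward m n) l"
  shows "inj_on (\<lambda>i. l (Inl i)) {..<m}" and "inj_on (\<lambda>j. l (Inr j)) {..<n}"
proof -
  have trivial: "map_sum \<alpha> \<beta> = id"
    if "\<alpha> permutes {..<m}" "\<beta> permutes {..<n}"
      and "\<And>i. i < m \<Longrightarrow> l (Inl (\<alpha> i)) = l (Inl i)" "\<And>j. j < n \<Longrightarrow> l (Inr (\<beta> j)) = l (Inr j)"
    for \<alpha> \<beta>
  proof -
    have "ograph_aut (forward m n) (map_sum \<alpha> \<beta>)"
      using that by (simp add: ograph_aut_bip_orient)
    moreover have "\<forall>u\<in>verts (forward m n). l (map_sum \<alpha> \<beta> u) = l u"
      using that by (auto simp: verts_bip_orient)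
    ultimately show ?thesis using dist unfolding distinguishing_verts_def by blast
  qed
  show "inj_on (\<lambda>i. l (Inl i)) {..<m}"
  proof (rule inj_onI)
    fix s t assume "s \<in> {..<m}" "t \<in> {..<m}" "l (Inl s) = l (Inl t)"
    then have "map_sum (transpose s t) id = (id :: nat + nat \<Rightarrow> nat + nat)"
      by (intro trivial permutes_id permutes_swap_id) (auto simp: transpose_def)
    then show "s = t" by (metis map_sum_eq_id_iff id_apply transpose_apply_first)
  qed
  show "inj_on (\<lambda>j. l (Inr j)) {..<n}"
  proof (rule inj_onI)
    fix s t assume "s \<in> {..<n}" "t \<in> {..<n}" "l (Inr s) = l (Inr t)"
    then have "map_sum id (transpose s t) = (id :: nat + nat \<Rightarrow> nat + nat)"
      by (intro trivial permutes_id permutes_swap_id) (auto simp: transpose_def)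
    then show "s = t" by (metis map_sum_eq_id_iff id_apply transpose_apply_first)
  qed
qed

text \<open>The converse of copying labels from edges to arcs: every automorphism of the complete
  bipartite graph is one of this orientation, so the arc labels read as edge labels must break them
  all.\<close>

lemma forward_distinguishing_arcs:
  assumes "m < n" and dist: "distinguishing_arcs (forward m n) l"
  shows "distinguishing_edges (complete_bipartite m n) (bip_label (\<lambda>i j. l (Inl i, Inr j)))"
  unfolding distinguishing_edges_def
proof (intro allI impI, elim conjE)
  fix \<phi>
  assume aut: "graph_aut (complete_bipartite m n) \<phi>"
    and lab: "\<forall>e\<in>edges (complete_bipartite m n).
      bip_label (\<lambda>i j. l (Inl i, Inr j)) (\<phi> ` e) = bip_label (\<lambda>i j. l (Inl i, Inr j)) e"
  obtain \<alpha> \<beta> where \<alpha>: "\<alpha> permutes {..<m}" and \<beta>: "\<beta> permutes {..<n}" and \<phi>: "\<phi> = map_sum \<alpha> \<beta>"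
    using graph_aut_complete_bipartite[OF assms(1) aut] .
  have "ograph_aut (forward m n) \<phi>"
    using \<alpha> \<beta> by (simp add: \<phi> ograph_aut_bip_orient)
  moreover have "l (Inl (\<alpha> i), Inr (\<beta> j)) = l (Inl i, Inr j)" if "i < m" "j < n" for i j
    using lab[rule_format, of "{Inl i, Inr j}"] that by (simp add: \<phi>)
  then have "\<forall>(u, v)\<in>arcs (forward m n). l (\<phi> u, \<phi> v) = l (u, v)"
    by (auto elim!: bip_orient_arcE simp: \<phi>)
  ultimately show "\<phi> = id"
    using dist unfolding distinguishing_arcs_def by blast
qed

text \<open>For m < n no automorphism moves a vertex to the other part, so labels have to differ
  only within each part and may repeat across the parts.\<close>

lemma distinguishing_verts_bipartite:
  assumes "m < n" and H: "orientation (complete_bipartite m n) H"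
    and inj: "inj_on (\<lambda>i. l (Inl i)) {..<m}" "inj_on (\<lambda>j. l (Inr j)) {..<n}"
  shows "distinguishing_verts H l"
  unfolding distinguishing_verts_def
proof (intro allI impI, elim conjE)
  fix \<phi> assume aut: "ograph_aut H \<phi>" and lab: "\<forall>u\<in>verts H. l (\<phi> u) = l u"
  obtain \<alpha> \<beta> where \<alpha>: "\<alpha> permutes {..<m}" and \<beta>: "\<beta> permutes {..<n}" and \<phi>: "\<phi> = map_sum \<alpha> \<beta>"
    using graph_aut_complete_bipartite[OF assms(1) ograph_aut_imp_graph_aut[OF H aut]] .
  have verts: "verts H = Inl ` {..<m} \<union> Inr ` {..<n}"
    using orientation_verts[OF H] by (simp add: verts_complete_bipartite)
  have "\<alpha> i = i" for i
  proof (cases "i \<in> {..<m}")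
    case True
    then show ?thesis
      using inj_onD[OF inj(1), of "\<alpha> i" i] lab[rule_format, of "Inl i"] permutes_in_image[OF \<alpha>, of i] by (simp add: verts \<phi>)
  qed (simp add: permutes_not_in[OF \<alpha>])
  moreover have "\<beta> j = j" for j
  proof (cases "j \<in> {..<n}")
    case True
    then show ?thesis
      using inj_onD[OF inj(2), of "\<beta> j" j] lab[rule_format, of "Inr j"] permutes_in_image[OF \<beta>, of j] by (simp add: verts \<phi>)
  qed (simp add: permutes_not_in[OF \<beta>])
  ultimately show "\<phi> = id" by (auto simp: \<phi> map_sum_eq_id_iff)
qed

section \<open>The parameters of an arbitrary orientation\<close>

context
  fixes m n :: nat and H :: "(nat + nat) ograph"
  assumes m: "2 \<le> m" and mn: "m < n" and H: "orientation (complete_bipartite m n) H"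
begin

lemma verts_H: "verts H = Inl ` {..<m} \<union> Inr ` {..<n}"
  using orientation_verts[OF H] by (simp add: verts_complete_bipartite)

lemma proper_verts_bipartite:
  assumes "\<And>i j. i < m \<Longrightarrow> j < n \<Longrightarrow> f i \<noteq> g j"
  shows "proper_verts H (case_sum f g)"
proof -
  have "case_sum f g u \<noteq> case_sum f g v" if "(u, v) \<in> arcs H" for u v
    using orientation_arc_edge[OF H that] assms by (cases u; cases v) (auto simp: eq_commute)
  then show ?thesis by (auto simp: proper_verts_def)
qed

text \<open>Both parts reuse the same labels, and the larger part dictates n. Like the other
  witnesses below, this serves twice: as an upper bound, and to make the minimum attained for the
  lower bound.\<close>

lemma D_witness: "\<exists>l \<in> verts H \<rightarrow> {1..n}. distinguishing_verts H l"
proof (rule bexI[of _ "case_sum Suc Suc"])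
  show "distinguishing_verts H (case_sum Suc Suc)"
    using mn H by (rule distinguishing_verts_bipartite) (auto simp: inj_on_def)
qed (use mn in \<open>auto simp: verts_H\<close>)

lemma chiD_witness:
  "\<exists>l \<in> verts H \<rightarrow> {1..m + n}. proper_verts H l \<and> distinguishing_verts H l"
proof (rule bexI[of _ "case_sum Suc (\<lambda>j. Suc (m + j))"], rule conjI)
  show "distinguishing_verts H (case_sum Suc (\<lambda>j. Suc (m + j)))"
    using mn H by (rule distinguishing_verts_bipartite) (auto simp: inj_on_def)
  show "proper_verts H (case_sum Suc (\<lambda>j. Suc (m + j)))"
    by (rule proper_verts_bipartite) simp
qed (auto simp: verts_H)

lemma D'_witness:
  "\<exists>l \<in> arcs H \<rightarrow> {1..D'_graph (complete_bipartite m n)}. distinguishing_arcs H l"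
proof -
  have "1 \<le> n" using mn by simp
  then obtain l where "l \<in> edges (complete_bipartite m n) \<rightarrow> {1..D'_graph (complete_bipartite m n)}"
    and "distinguishing_edges (complete_bipartite m n) l"
    using D'_graph_attained[OF m] by blast
  then show ?thesis
    using edge_labelling_on_arcs[OF H] distinguishing_arcs_of_edges[OF H] by blast
qed

lemma chi'D_witness: "\<exists>l \<in> arcs H \<rightarrow> {1..n}. proper_arcs H l \<and> distinguishing_arcs H l"
proof -
  have "cyclic_label n \<in> edges (complete_bipartite m n) \<rightarrow> {1..n}"
    using mn by (auto simp: edges_complete_bipartite Suc_le_eq)
  moreover have "distinguishing_edges (complete_bipartite m n) (cyclic_label n)"
    using m mn by (intro cyclic_label_distinguishing) auto
  ultimately show ?thesis
    using edge_labelling_on_arcs[OF H] distinguishing_arcs_of_edges[OF H]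
      cyclic_label_proper[OF mn H] by blast
qed

text \<open>Excludes degenerate label ranges: a vertex or an arc rules out \<open>r = 0\<close>, and
  the two ends of an arc need two colours in a proper vertex colouring.\<close>

lemma arc_exists: "\<exists>u v. (u, v) \<in> arcs H \<and> u \<in> verts H \<and> v \<in> verts H"
proof -
  have "{Inl 0, Inr 0} \<in> edges (complete_bipartite m n)" using m mn by simp
  then show ?thesis using orientation_edge_arc[OF H] m mn by (fastforce simp: verts_H)
qed

lemma D_bounds: "1 \<le> D_ograph H" "D_ograph H \<le> n"
proof -
  show "1 \<le> D_ograph H"
    unfolding D_ograph_def by (rule ge_Least, rule D_witness) (use arc_exists in fastforce)
  show "D_ograph H \<le> n"
    unfolding D_ograph_def by (rule Least_le) (rule D_witness)
qed

lemma chiD_bounds: "2 \<le> chiD_ograph H" "chiD_ograph H \<le> m + n"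
proof -
  show "2 \<le> chiD_ograph H"
    unfolding chiD_ograph_def
  proof (rule ge_Least, rule chiD_witness)
    fix r
    assume "\<exists>l \<in> verts H \<rightarrow> {1..r}. proper_verts H l \<and> distinguishing_verts H l"
    then obtain l where l: "l \<in> verts H \<rightarrow> {1..r}" "proper_verts H l" by blast
    obtain u v where uv: "(u, v) \<in> arcs H" "u \<in> verts H" "v \<in> verts H" using arc_exists by blast
    then have "l u \<noteq> l v" "l u \<in> {1..r}" "l v \<in> {1..r}" using l by (auto simp: proper_verts_def)
    then show "2 \<le> r" by auto
  qed
  show "chiD_ograph H \<le> m + n"
    unfolding chiD_ograph_def by (rule Least_le) (rule chiD_witness)
qed

lemma D'_bounds: "1 \<le> D'_ograph H" "D'_ograph H \<le> D'_graph (complete_bipartite m n)"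
proof -
  show "1 \<le> D'_ograph H"
    unfolding D'_ograph_def by (rule ge_Least, rule D'_witness) (use arc_exists in fastforce)
  show "D'_ograph H \<le> D'_graph (complete_bipartite m n)"
    unfolding D'_ograph_def by (rule Least_le) (rule D'_witness)
qed

text \<open>The cyclic colouring attains the value and the degree of a vertex in the small part
  bounds it from below, so it is the same for every orientation.\<close>

lemma chi'D_eq: "chi'D_ograph H = n"
  unfolding chi'D_ograph_def
proof (rule Least_equality)
  show "\<exists>l \<in> arcs H \<rightarrow> {1..n}. proper_arcs H l \<and> distinguishing_arcs H l"
    by (rule chi'D_witness)
  show "n \<le> r" if "\<exists>l \<in> arcs H \<rightarrow> {1..r}. proper_arcs H l \<and> distinguishing_arcs H l" for r
    using that proper_arcs_ge[OF _ H] m by auto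
qed

text \<open>Without nontrivial automorphisms every labelling is distinguishing: constant labels do,
  and the bipartition gives the proper colouring.\<close>

lemma rigid_parameters:
  assumes "rigid H"
  shows "D_ograph H \<le> 1" and "D'_ograph H \<le> 1" and "chiD_ograph H \<le> 2"
proof -
  have dist: "distinguishing_verts H l" "distinguishing_arcs H l'" for l l'
    using assms by (auto simp: rigid_def distinguishing_verts_def distinguishing_arcs_def)
  show "D_ograph H \<le> 1"
    unfolding D_ograph_def using dist by (intro Least_le bexI[of _ "\<lambda>_. 1"]) auto
  show "D'_ograph H \<le> 1"
    unfolding D'_ograph_def using dist by (intro Least_le bexI[of _ "\<lambda>_. 1"]) auto
  have "proper_verts H (case_sum (\<lambda>_. 1) (\<lambda>_. 2))"
    by (rule proper_verts_bipartite) simp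
  then show "chiD_ograph H \<le> 2"
    unfolding chiD_ograph_def using dist
    by (intro Least_le bexI[of _ "case_sum (\<lambda>_. 1) (\<lambda>_. 2)"]) (auto simp: verts_H)
qed

end

text \<open>These lower bounds meet the upper bounds that hold for all orientations, so this
  orientation attains the maxima.\<close>

lemma forward_parameters:
  assumes "2 \<le> m" and "m < n"
  shows "n \<le> D_ograph (forward m n)" and "m + n \<le> chiD_ograph (forward m n)"
    and "D'_graph (complete_bipartite m n) \<le> D'_ograph (forward m n)"
proof -
  note H = orientation_bip_orient[of m n "\<lambda>i j. True"]
  show "n \<le> D_ograph (forward m n)"
    unfolding D_ograph_def
  proof (rule ge_Least, rule D_witness[OF assms H])
    fix r assume "\<exists>l \<in> verts (forward m n) \<rightarrow> {1..r}. distinguishing_verts (forward m n) l"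
    then obtain l where l: "l \<in> verts (forward m n) \<rightarrow> {1..r}"
      and dist: "distinguishing_verts (forward m n) l" by blast
    have "(\<lambda>j. l (Inr j)) ` {..<n} \<subseteq> {1..r}" using l by (auto simp: verts_bip_orient)
    then have "card {..<n} \<le> card {1..r}"
      by (intro card_inj_on_le[OF forward_distinguishing_inj(2)[OF dist]]) auto
    then show "n \<le> r" by simp
  qed
  show "m + n \<le> chiD_ograph (forward m n)"
    unfolding chiD_ograph_def
  proof (rule ge_Least, rule chiD_witness[OF assms H])
    fix r
    assume "\<exists>l \<in> verts (forward m n) \<rightarrow> {1..r}.
      proper_verts (forward m n) l \<and> distinguishing_verts (forward m n) l"
    then obtain l where l: "l \<in> verts (forward m n) \<rightarrow> {1..r}" and proper: "proper_verts (forward m n) l"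
      and dist: "distinguishing_verts (forward m n) l" by blast
    have ne: "l (Inl i) \<noteq> l (Inr j)" if "i < m" "j < n" for i j
    proof -
      have "(Inl i, Inr j) \<in> arcs (forward m n)" using that by simp
      then show ?thesis using proper unfolding proper_verts_def by blast
    qed
    let ?L = "(\<lambda>i. l (Inl i)) ` {..<m}" and ?R = "(\<lambda>j. l (Inr j)) ` {..<n}"
    \<comment> \<open>Vertices from different parts are always adjacent, so the parts use disjoint
      sets of colours, each as large as its part.\<close>
    have "card (?L \<union> ?R) = card ?L + card ?R"
      by (rule card_Un_disjoint) (use ne in auto)
    moreover have "?L \<union> ?R \<subseteq> {1..r}" using l by (auto simp: verts_bip_orient)
    then have "card (?L \<union> ?R) \<le> r" using card_mono[of "{1..r}"] by fastforce
    ultimately show "m + n \<le> r"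
      using forward_distinguishing_inj[OF dist] by (simp add: card_image)
  qed
  show "D'_graph (complete_bipartite m n) \<le> D'_ograph (forward m n)"
    unfolding D'_ograph_def
  proof (rule ge_Least, rule D'_witness[OF assms H])
    fix r assume "\<exists>l \<in> arcs (forward m n) \<rightarrow> {1..r}. distinguishing_arcs (forward m n) l"
    then obtain l where l: "l \<in> arcs (forward m n) \<rightarrow> {1..r}"
      and dist: "distinguishing_arcs (forward m n) l" by blast
    have "bip_label (\<lambda>i j. l (Inl i, Inr j)) \<in> edges (complete_bipartite m n) \<rightarrow> {1..r}"
    proof
      fix e assume "e \<in> edges (complete_bipartite m n)"
      then obtain i j where e: "e = {Inl i, Inr j}" "i < m" "j < n"
        by (auto simp: edges_complete_bipartite)
      then have "(Inl i, Inr j) \<in> arcs (forward m n)" by simp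
      then show "bip_label (\<lambda>i j. l (Inl i, Inr j)) e \<in> {1..r}"
        using funcset_mem[OF l] by (simp only: e(1) bip_label)
    qed
    then show "D'_graph (complete_bipartite m n) \<le> r"
      unfolding D'_graph_def using forward_distinguishing_arcs[OF assms(2) dist]
      by (intro Least_le) blast
  qed
qed

section \<open>The nested orientation\<close>

text \<open>Remainders modulo \<open>m - 1\<close> stop at \<open>m - 2\<close>, so
  \<open>Inl (m - 1)\<close> has no out-arcs. The quotient \<open>j div (m - 1)\<close> numbers the
  vertices within a class of equal in-neighbourhood.\<close>

abbreviation nested :: "nat \<Rightarrow> nat \<Rightarrow> (nat + nat) ograph" where
  "nested m n \<equiv> bip_orient m n (\<lambda>i j. i \<le> j mod (m - 1))"

text \<open>The out-neighbourhoods \<open>N i\<close> of the small part form a strictly decreasing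
  chain, so out-degrees fix that part pointwise. Then in-neighbourhoods in the large part, and hence
  remainders, are preserved.\<close>

lemma nested_aut:
  assumes "2 \<le> m" and "m < n" and aut: "ograph_aut (nested m n) \<phi>"
  obtains \<beta> where "\<beta> permutes {..<n}" and "\<phi> = map_sum id \<beta>"
    and "\<And>j. j < n \<Longrightarrow> \<beta> j mod (m - 1) = j mod (m - 1)"
proof -
  obtain \<alpha> \<beta> where \<alpha>: "\<alpha> permutes {..<m}" and \<beta>: "\<beta> permutes {..<n}" and \<phi>: "\<phi> = map_sum \<alpha> \<beta>"
    using graph_aut_complete_bipartite[OF assms(2) ograph_aut_imp_graph_aut[OF orientation_bip_orient aut]] .
  have R: "\<alpha> i \<le> \<beta> j mod (m - 1) \<longleftrightarrow> i \<le> j mod (m - 1)" if "i < m" "j < n" for i j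
    using aut that unfolding \<phi> ograph_aut_bip_orient[OF \<alpha> \<beta>] by blast
  have mod_less: "j mod (m - 1) < m - 1" for j using assms(1) by simp
  define N where "N i = {j \<in> {..<n}. i \<le> j mod (m - 1)}" for i
  have "N (\<alpha> i) = \<beta> ` N i" if "i < m" for i
  proof
    show "\<beta> ` N i \<subseteq> N (\<alpha> i)"
      using R[OF that] permutes_in_image[OF \<beta>] by (auto simp: N_def)
    show "N (\<alpha> i) \<subseteq> \<beta> ` N i"
    proof
      fix k assume k: "k \<in> N (\<alpha> i)"
      then obtain j where "j < n" "k = \<beta> j"
        using permutes_image[OF \<beta>] by (auto simp: N_def)
      then show "k \<in> \<beta> ` N i" using k R[OF that] by (auto simp: N_def)
    qed
  qed
  then have card_N: "card (N (\<alpha> i)) = card (N i)" if "i < m" for i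
    using that card_image[OF inj_on_subset[OF permutes_inj[OF \<beta>] subset_UNIV]] by simp
  have card_less: "card (N k) < card (N i)" if "i < k" "k < m" for i k
  proof (rule psubset_card_mono)
    \<comment> \<open>From \<open>i < k\<close> and \<open>k < m\<close> follows
      \<open>i < m - 1\<close>, so column \<open>i\<close> has remainder \<open>i\<close> and
      separates the two sets; it is a column because m < n.\<close>
    have "i \<in> N i - N k" using that assms(2) by (simp add: N_def)
    moreover have "N k \<subseteq> N i" using that by (auto simp: N_def)
    ultimately show "N k \<subset> N i" by blast
  qed (simp add: N_def)
  have "\<alpha> i = i" for i
  proof (cases "i < m")
    case True
    then have "\<alpha> i < m" using permutes_in_image[OF \<alpha>, of i] by simp
    then show ?thesis
      using card_N[OF True] card_less[of i "\<alpha> i"] card_less[of "\<alpha> i" i] True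
      by (metis less_irrefl nat_neq_iff)
  qed (simp add: permutes_not_in[OF \<alpha>])
  then have \<alpha>_id: "\<alpha> = id" by auto
  have "\<beta> j mod (m - 1) = j mod (m - 1)" if "j < n" for j
  proof (rule antisym)
    \<comment> \<open>Testing \<open>R\<close> in the row whose index is the remainder itself makes
      one side of the equivalence trivially true.\<close>
    show "\<beta> j mod (m - 1) \<le> j mod (m - 1)"
      using R[of "\<beta> j mod (m - 1)" j] mod_less[of "\<beta> j"] that by (simp add: \<alpha>_id)
    show "j mod (m - 1) \<le> \<beta> j mod (m - 1)"
      using R[of "j mod (m - 1)" j] mod_less[of j] that by (simp add: \<alpha>_id)
  qed
  then show thesis using that \<beta> \<phi> \<alpha>_id by blast
qed

text \<open>Every automorphism preserves remainders, so by division with remainder a labelling only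
  has to recover the quotients.\<close>

lemma nested_aut_eq_id:
  assumes "2 \<le> m" and "m < n" and aut: "ograph_aut (nested m n) \<phi>"
    and div: "\<And>j k. j < n \<Longrightarrow> k < n \<Longrightarrow> \<phi> (Inr j) = Inr k \<Longrightarrow> k div (m - 1) = j div (m - 1)"
  shows "\<phi> = id"
proof -
  obtain \<beta> where \<beta>: "\<beta> permutes {..<n}" and \<phi>: "\<phi> = map_sum id \<beta>"
    and mod: "\<And>j. j < n \<Longrightarrow> \<beta> j mod (m - 1) = j mod (m - 1)"
    using nested_aut[OF assms(1-3)] by blast
  have "\<beta> j = j" for j
  proof (cases "j < n")
    case True
    then have "\<beta> j div (m - 1) = j div (m - 1)"
      using div[of j "\<beta> j"] permutes_in_image[OF \<beta>, of j] by (simp add: \<phi>)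
    then show ?thesis using mod[OF True] by (metis div_mult_mod_eq)
  qed (simp add: permutes_not_in[OF \<beta>])
  then show ?thesis by (auto simp: \<phi> map_sum_eq_id_iff)
qed

text \<open>The quotients \<open>j div (m - 1)\<close> lie below \<open>q\<close>. On vertices they
  serve as labels directly; on arcs they are encoded by the q columns of an optimal labelling of
  \<open>complete_bipartite m q\<close>.\<close>

lemma nested_parameters:
  assumes m: "2 \<le> m" and mn: "m < n" and q: "n \<le> q * (m - 1)"
  shows "D_ograph (nested m n) \<le> q" and "chiD_ograph (nested m n) \<le> 1 + q"
    and "D'_ograph (nested m n) \<le> D'_graph (complete_bipartite m q)"
proof -
  have div_less: "j div (m - 1) < q" if "j < n" for j
    using that q by (intro less_mult_imp_div_less) simp
  have "1 \<le> q" using q mn by (cases q) auto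
  \<comment> \<open>The labels \<open>f\<close> on the small part are free because that part is
    fixed pointwise: the constant 1 spends no extra label, and \<open>1 + q\<close> keeps the
    colouring proper.\<close>
  have verts_dist: "distinguishing_verts (nested m n) (case_sum f (\<lambda>j. Suc (j div (m - 1))))" for f
    unfolding distinguishing_verts_def
  proof (intro allI impI, elim conjE)
    fix \<phi>
    assume aut: "ograph_aut (nested m n) \<phi>"
      and lab: "\<forall>u\<in>verts (nested m n). case_sum f (\<lambda>j. Suc (j div (m - 1))) (\<phi> u) =
        case_sum f (\<lambda>j. Suc (j div (m - 1))) u"
    show "\<phi> = id"
    proof (rule nested_aut_eq_id[OF m mn aut])
      fix j k assume "j < n" "k < n" "\<phi> (Inr j) = Inr k"
      then show "k div (m - 1) = j div (m - 1)"
        using lab[rule_format, of "Inr j"] by (simp add: verts_bip_orient)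
    qed
  qed
  show "D_ograph (nested m n) \<le> q"
    unfolding D_ograph_def
    by (intro Least_le bexI[where x = "case_sum (\<lambda>_. 1) (\<lambda>j. Suc (j div (m - 1)))"] verts_dist)
      (use \<open>1 \<le> q\<close> div_less in \<open>auto simp: verts_bip_orient Suc_le_eq\<close>)
  have "proper_verts (nested m n) (case_sum (\<lambda>_. 1 + q) (\<lambda>j. Suc (j div (m - 1))))"
    using div_less by (fastforce simp: proper_verts_def elim!: bip_orient_arcE)
  then show "chiD_ograph (nested m n) \<le> 1 + q"
    unfolding chiD_ograph_def
    by (intro Least_le bexI[where x = "case_sum (\<lambda>_. 1 + q) (\<lambda>j. Suc (j div (m - 1)))"]
        conjI verts_dist)
      (use div_less in \<open>auto simp: verts_bip_orient less_imp_le\<close>)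
  obtain l where l: "l \<in> edges (complete_bipartite m q) \<rightarrow> {1..D'_graph (complete_bipartite m q)}"
    and dist: "distinguishing_edges (complete_bipartite m q) l"
    using D'_graph_attained[OF m \<open>1 \<le> q\<close>] .
  \<comment> \<open>Column \<open>j\<close> repeats column \<open>j div (m - 1)\<close> of the
    optimal labelling \<open>l\<close>.\<close>
  define l' where "l' = bip_label (\<lambda>i j. l {Inl i, Inr (j div (m - 1))})"
  have "l' \<in> edges (complete_bipartite m n) \<rightarrow> {1..D'_graph (complete_bipartite m q)}"
  proof
    fix e assume "e \<in> edges (complete_bipartite m n)"
    then obtain i j where e: "e = {Inl i, Inr j}" "i < m" "j < n"
      by (auto simp: edges_complete_bipartite)
    then have "{Inl i, Inr (j div (m - 1))} \<in> edges (complete_bipartite m q)"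
      using div_less by simp
    then show "l' e \<in> {1..D'_graph (complete_bipartite m q)}"
      using funcset_mem[OF l] by (simp only: e(1) l'_def bip_label)
  qed
  then have "(\<lambda>(u, v). l' {u, v}) \<in> arcs (nested m n) \<rightarrow> {1..D'_graph (complete_bipartite m q)}"
    by (rule edge_labelling_on_arcs[OF orientation_bip_orient])
  moreover have "distinguishing_arcs (nested m n) (\<lambda>(u, v). l' {u, v})"
    unfolding distinguishing_arcs_def
  proof (intro allI impI, elim conjE)
    fix \<phi>
    assume aut: "ograph_aut (nested m n) \<phi>"
      and lab: "\<forall>(u, v)\<in>arcs (nested m n).
        (\<lambda>(u, v). l' {u, v}) (\<phi> u, \<phi> v) = (\<lambda>(u, v). l' {u, v}) (u, v)"
    obtain \<beta> where \<phi>: "\<phi> = map_sum id \<beta>" using nested_aut[OF m mn aut] by blast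
    show "\<phi> = id"
    proof (rule nested_aut_eq_id[OF m mn aut])
      fix j k assume jk: "j < n" "k < n" "\<phi> (Inr j) = Inr k"
      \<comment> \<open>\<open>\<phi>\<close> fixes every row and preserves labels, so the columns
        of \<open>j\<close> and \<open>k\<close> agree entry by entry, and a distinguishing
        \<open>l\<close> has no two equal columns.\<close>
      show "k div (m - 1) = j div (m - 1)"
      proof (rule distinguishing_edges_columns[OF dist])
        fix i assume "i < m"
        have fixed: "\<phi> (Inl i) = Inl i" by (simp add: \<phi>)
        have "l' {Inl i, Inr k} = l' {Inl i, Inr j}"
        proof (cases "i \<le> j mod (m - 1)")
          case True
          then have "(Inl i, Inr j) \<in> arcs (nested m n)" using \<open>i < m\<close> jk by simp
          then show ?thesis using lab fixed jk(3) by fastforce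
        next
          case False
          then have "(Inr j, Inl i) \<in> arcs (nested m n)" using \<open>i < m\<close> jk by simp
          then show ?thesis using lab fixed jk(3) by (fastforce simp: insert_commute)
        qed
        then show "l {Inl i, Inr (k div (m - 1))} = l {Inl i, Inr (j div (m - 1))}"
          by (simp add: l'_def)
      qed (use jk div_less in auto)
    qed
  qed
  ultimately show "D'_ograph (nested m n) \<le> D'_graph (complete_bipartite m q)"
    unfolding D'_ograph_def by (intro Least_le) blast
qed

section \<open>Assembly of the maxima and minima\<close>

theorem theorem15:
  fixes m n :: nat
  assumes "2 \<le> m" and "m < n"
  shows "let K = complete_bipartite m n; q = nat \<lceil>real n / (real m - 1)\<rceil> in
     (D_max K = n \<and> chi'D_max K = n \<and> D'_max K = D'_graph K \<and> chiD_max K = m + n) \<and>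
     ((\<exists>H. orientation K H \<and> rigid H) \<longrightarrow>
        D_min K = 1 \<and> D'_min K = 1 \<and> chiD_min K = 2 \<and> chi'D_min K = n) \<and>
     (\<not> (\<exists>H. orientation K H \<and> rigid H) \<longrightarrow>
        D_min K \<le> q \<and> chiD_min K \<le> 1 + q \<and>
        D'_min K \<le> D'_graph (complete_bipartite m q) \<and> chi'D_min K = n)"
proof -
  define K where "K = complete_bipartite m n"
  define q where "q = nat \<lceil>real n / (real m - 1)\<rceil>"
  have "real n / (real m - 1) \<le> real q" unfolding q_def by linarith
  \<comment> \<open>\<open>2 \<le> m\<close> makes the denominator positive here and the natural
    subtraction \<open>m - 1\<close> exact in the next line.\<close>
  then have "real n \<le> real q * (real m - 1)" using assms(1) by (simp add: field_simps)
  also have "\<dots> = real (q * (m - 1))" using assms(1) by (simp add: of_nat_diff)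
  finally have q: "n \<le> q * (m - 1)" by (simp only: of_nat_le_iff)
  define F where "F = forward m n"
  define N where "N = nested m n"
  have F: "orientation K F" and N: "orientation K N"
    unfolding K_def F_def N_def by (rule orientation_bip_orient)+
  note le_min = min_orient_le[of m n, folded K_def]
    and eq_min = min_orient_eq[of m n, folded K_def]
    and eq_max = max_orient_eq[of m n, folded K_def]
    and D = D_bounds[OF assms, folded K_def] and D' = D'_bounds[OF assms, folded K_def]
    and chiD = chiD_bounds[OF assms, folded K_def] and chi'D = chi'D_eq[OF assms, folded K_def]
    and forward = forward_parameters[OF assms, folded K_def F_def]
    and nested = nested_parameters[OF assms q, folded N_def]
  have "D_max K = n" using F forward(1) D(2) by (rule eq_max)
  moreover have "chiD_max K = m + n" using F forward(2) chiD(2) by (rule eq_max)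
  moreover have "D'_max K = D'_graph K" using F forward(3) D'(2) by (rule eq_max)
  \<comment> \<open>\<open>chi'D_ograph\<close> is constant on the orientations of \<open>K\<close>,
    so any of them, here \<open>F\<close>, attains both extremes.\<close>
  moreover have "chi'D_max K = n" using F by (rule eq_max) (simp_all add: chi'D F)
  moreover have "chi'D_min K = n" using F by (rule eq_min) (simp_all add: chi'D F)
  moreover have "D_min K = 1 \<and> D'_min K = 1 \<and> chiD_min K = 2" if H: "orientation K H" "rigid H" for H
  proof (intro conjI)
    note rigid = rigid_parameters[OF assms H(1)[unfolded K_def] H(2)]
    show "D_min K = 1" using H(1) rigid(1) D(1) by (rule eq_min)
    show "D'_min K = 1" using H(1) rigid(2) D'(1) by (rule eq_min)
    show "chiD_min K = 2" using H(1) rigid(3) chiD(1) by (rule eq_min)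
  qed
  moreover have "D_min K \<le> q" using le_min[OF N, of D_ograph] nested(1) by linarith
  moreover have "chiD_min K \<le> 1 + q" using le_min[OF N, of chiD_ograph] nested(2) by linarith
  moreover have "D'_min K \<le> D'_graph (complete_bipartite m q)"
    using le_min[OF N, of D'_ograph] nested(3) by linarith
  ultimately show ?thesis
    unfolding Let_def K_def[symmetric] q_def[symmetric] by blast
qed

end
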